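(* Let $(X,d)$ and $(Y,e)$ be metric spaces, $E\subseteq X$, $f:E\to Y$. Let $K,L\subseteq\mathbb N$ and $\alpha:K\to X$, $\beta:L\to Y$, and let $r_0,r_1,\ldots$ be a computable sequence of positive rationals having $0$ as an accumulation point. Suppose $(X,d,\alpha)$ and $(Y,e,\beta)$ are semi-computable metric spaces. If $f$ is $(\alpha,\beta)$-computable, then there exists a saturated recursively enumerable metric $(\alpha,\beta)$-approximation system for $f$.
   Context: A semi-computable metric space is a triple $(Z,\rho,\gamma)$ where $(Z,\rho)$ is a metric space, $\gamma$ is a partial map from $\mathbb N$ to $Z$ with $\mathrm{rng}(\gamma)$ dense in $Z$, and the set $\{(l,l',p,q)\mid l,l'\in\mathrm{dom}(\gamma),\ p,q\in\mathbb N\setminus\{0\},\ \rho(\gamma(l),\gamma(l'))<p/q\}$ is recursively enumerable ($\alpha$, $\beta$ are regarded as partial maps on $\mathbb N$ with domains $K$, $L$). A metric $(\alpha,\beta)$-approximation system for $f$ is a subset $S\subseteq K\times\mathbb N\times L\times\mathbb N$ such that for every $x\in E$: (a) for all $(k,m,l,n)\in S$, if $d(\alpha(k),x)<r_m$ then $e(\beta(l),f(x))<r_n$; (b) for every $n$ there is $m$ such that for every $k\in K$ with $d(\alpha(k),x)<r_m$ there exists $l$ with $(k,m,l,n)\in S$. $S$ is saturated if whenever $(k,m,l,n)\in S$, $\bar k\in K$, $\bar l\in L$, $\alpha(\bar k)=\alpha(k)$, $\beta(\bar l)=\beta(l)$, then $(\bar k,m,\bar l,n)\in S$. An $\alpha$-name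 of $x\in X$ is a total $u:\mathbb N\to K$ with $d(\alpha(u(t)),x)<r_t$ for all $t$; $\beta$-names of $y\in Y$ analogously with $e,\beta,L$. $f$ is $(\alpha,\beta)$-computable if there is a recursive operator $F$ with $F(u)$ a $\beta$-name of $f(x)$ whenever $x\in E$ and $u$ is an $\alpha$-name of $x$. *)

theory Defs
  imports "HOL-Analysis.Analysis" "HOL-Library.Nat_Bijection"
begin

text \<open>
  \<open>recursive k f\<close>: the total function \<open>\<nat>\<^sup>k \<rightarrow> \<nat>\<close> given by \<open>f\<close> on lists of length \<open>k\<close> is
  general recursive. The values of \<open>f\<close> on lists of other lengths are irrelevant, which is
  what the last rule expresses.
\<close>

inductive recursive :: "nat \<Rightarrow> (nat list \<Rightarrow> nat) \<Rightarrow> bool" where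
  zero: "recursive k (\<lambda>xs. 0)"
| succ: "recursive 1 (\<lambda>xs. Suc (xs ! 0))"
| proj: "i < k \<Longrightarrow> recursive k (\<lambda>xs. xs ! i)"
| comp: "recursive (length hs) g \<Longrightarrow> (\<And>h. h \<in> set hs \<Longrightarrow> recursive k h)
    \<Longrightarrow> recursive k (\<lambda>xs. g (map (\<lambda>h. h xs) hs))"
| prim_rec: "recursive k g \<Longrightarrow> recursive (k + 2) h
    \<Longrightarrow> recursive (k + 1) (\<lambda>xs. rec_nat (g (tl xs)) (\<lambda>n y. h (n # y # tl xs)) (hd xs))"
| minimization: "recursive (k + 1) g \<Longrightarrow> (\<And>xs. length xs = k \<Longrightarrow> \<exists>n. g (n # xs) = 0)
    \<Longrightarrow> recursive k (\<lambda>xs. LEAST n. g (n # xs) = 0)"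
| ext: "recursive k f \<Longrightarrow> (\<And>xs. length xs = k \<Longrightarrow> g xs = f xs) \<Longrightarrow> recursive k g"

text \<open>A set of \<open>k\<close>-tuples is recursively enumerable if it is empty or the range of
  a recursive function \<open>\<nat> \<rightarrow> \<nat>\<^sup>k\<close>, given by its \<open>k\<close> recursive components.\<close>

definition rec_enumerable :: "nat \<Rightarrow> nat list set \<Rightarrow> bool" where
  "rec_enumerable k A \<longleftrightarrow>
     A = {} \<or>
     (\<exists>fs. length fs = k \<and> (\<forall>f\<in>set fs. recursive 1 f) \<and>
           A = range (\<lambda>t. map (\<lambda>f. f [t]) fs))"

definition rec_enumerable2 :: "(nat \<times> nat) set \<Rightarrow> bool" where
  "rec_enumerable2 A \<longleftrightarrow> rec_enumerable 2 {[a, b] | a b. (a, b) \<in> A}"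

definition rec_enumerable4 :: "(nat \<times> nat \<times> nat \<times> nat) set \<Rightarrow> bool" where
  "rec_enumerable4 A \<longleftrightarrow> rec_enumerable 4 {[a, b, c, d] | a b c d. (a, b, c, d) \<in> A}"

text \<open>Recursive operators in the sense of Rogers: enumeration operators that send (coded graphs of)
  partial functions to partial functions. \<open>set_decode v\<close> is the finite set with canonical
  index \<open>v\<close>.\<close>

definition enumeration_op :: "(nat \<times> nat) set \<Rightarrow> nat set \<Rightarrow> nat set" where
  "enumeration_op W A = {x. \<exists>v. (x, v) \<in> W \<and> set_decode v \<subseteq> A}"

definition coded_graph :: "(nat \<rightharpoonup> nat) \<Rightarrow> nat set" where
  "coded_graph \<phi> = {prod_encode (x, y) | x y. \<phi> x = Some y}"

definition recursive_operator :: "((nat \<rightharpoonup> nat) \<Rightarrow> (nat \<rightharpoonup> nat)) \<Rightarrow> bool" where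
  "recursive_operator F \<longleftrightarrow>
     (\<exists>W. rec_enumerable2 W \<and>
          (\<forall>\<phi>. coded_graph (F \<phi>) = enumeration_op W (coded_graph \<phi>)))"

definition computable_pos_rat_seq :: "(nat \<Rightarrow> rat) \<Rightarrow> bool" where
  "computable_pos_rat_seq r \<longleftrightarrow>
     (\<exists>p q. recursive 1 p \<and> recursive 1 q \<and>
            (\<forall>n. p [n] > 0 \<and> q [n] > 0 \<and> r n = of_nat (p [n]) / of_nat (q [n])))"

text \<open>Accumulation point of a sequence (not of its set of values).\<close>

definition seq_accumulation_point :: "(nat \<Rightarrow> rat) \<Rightarrow> rat \<Rightarrow> bool" where
  "seq_accumulation_point r a \<longleftrightarrow> (\<forall>\<epsilon>>0. \<exists>\<^sub>F n in sequentially. \<bar>r n - a\<bar> < \<epsilon>)"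

definition semi_computable_metric_space ::
  "'a set \<Rightarrow> ('a \<Rightarrow> 'a \<Rightarrow> real) \<Rightarrow> (nat \<rightharpoonup> 'a) \<Rightarrow> bool" where
  "semi_computable_metric_space Z \<rho> \<gamma> \<longleftrightarrow>
     Metric_space Z \<rho> \<and>
     ran \<gamma> \<subseteq> Z \<and>
     Metric_space.mtopology Z \<rho> closure_of ran \<gamma> = Z \<and>
     rec_enumerable4
       {(l, l', p, q). l \<in> dom \<gamma> \<and> l' \<in> dom \<gamma> \<and> p \<noteq> 0 \<and> q \<noteq> 0 \<and>
                       \<rho> (the (\<gamma> l)) (the (\<gamma> l')) < real p / real q}"

definition approximation_system ::
  "('a \<Rightarrow> 'a \<Rightarrow> real) \<Rightarrow> ('b \<Rightarrow> 'b \<Rightarrow> real) \<Rightarrow> (nat \<rightharpoonup> 'a) \<Rightarrow> (nat \<rightharpoonup> 'b) \<Rightarrow> (nat \<Rightarrow> rat) \<Rightarrow>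
   'a set \<Rightarrow> ('a \<Rightarrow> 'b) \<Rightarrow> (nat \<times> nat \<times> nat \<times> nat) set \<Rightarrow> bool" where
  "approximation_system d e \<alpha> \<beta> r E f S \<longleftrightarrow>
     S \<subseteq> dom \<alpha> \<times> UNIV \<times> dom \<beta> \<times> UNIV \<and>
     (\<forall>x\<in>E.
        (\<forall>(k, m, l, n)\<in>S. d (the (\<alpha> k)) x < of_rat (r m) \<longrightarrow> e (the (\<beta> l)) (f x) < of_rat (r n)) \<and>
        (\<forall>n. \<exists>m. \<forall>k\<in>dom \<alpha>. d (the (\<alpha> k)) x < of_rat (r m) \<longrightarrow> (\<exists>l. (k, m, l, n) \<in> S)))"

definition saturated ::
  "(nat \<rightharpoonup> 'a) \<Rightarrow> (nat \<rightharpoonup> 'b) \<Rightarrow> (nat \<times> nat \<times> nat \<times> nat) set \<Rightarrow> bool" where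
  "saturated \<alpha> \<beta> S \<longleftrightarrow>
     (\<forall>k m l n k' l'. (k, m, l, n) \<in> S \<and> k' \<in> dom \<alpha> \<and> l' \<in> dom \<beta> \<and> \<alpha> k' = \<alpha> k \<and> \<beta> l' = \<beta> l
        \<longrightarrow> (k', m, l', n) \<in> S)"

definition is_name ::
  "('a \<Rightarrow> 'a \<Rightarrow> real) \<Rightarrow> (nat \<rightharpoonup> 'a) \<Rightarrow> (nat \<Rightarrow> rat) \<Rightarrow> 'a \<Rightarrow> (nat \<Rightarrow> nat) \<Rightarrow> bool" where
  "is_name \<rho> \<gamma> r z u \<longleftrightarrow> (\<forall>t. u t \<in> dom \<gamma> \<and> \<rho> (the (\<gamma> (u t))) z < of_rat (r t))"

definition name_computable ::
  "('a \<Rightarrow> 'a \<Rightarrow> real) \<Rightarrow> ('b \<Rightarrow> 'b \<Rightarrow> real) \<Rightarrow> (nat \<rightharpoonup> 'a) \<Rightarrow> (nat \<rightharpoonup> 'b) \<Rightarrow> (nat \<Rightarrow> rat) \<Rightarrow>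
   'a set \<Rightarrow> ('a \<Rightarrow> 'b) \<Rightarrow> bool" where
  "name_computable d e \<alpha> \<beta> r E f \<longleftrightarrow>
     (\<exists>F. recursive_operator F \<and>
          (\<forall>x\<in>E. \<forall>u. is_name d \<alpha> r x u \<longrightarrow>
             (\<exists>v. F (Some \<circ> u) = Some \<circ> v \<and> is_name e \<beta> r (f x) v)))"

end

theory Submission
  imports Defs
begin

text \<open>
  Let \<open>W\<close> be the enumeration operator behind a recursive operator that computes \<open>f\<close> on names.
  If a finite function \<open>\<sigma>\<close> satisfies \<open>d (\<alpha> (\<sigma> t)) (\<alpha> k) < r t - r m\<close> on its domain, then it extends
  to a name of every \<open>x\<close> within \<open>r m\<close> of \<open>\<alpha> k\<close>; hence whatever \<open>W\<close> outputs from \<open>\<sigma>\<close> is correct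
  for all these \<open>x\<close> at once. Conversely, the output of \<open>W\<close> on a name \<open>u\<close> of \<open>x\<close> uses only finitely
  many values of \<open>u\<close>, whose strict inequalities \<open>d (\<alpha> (u t)) x < r t\<close> leave room for some \<open>r m\<close>.
\<close>

section \<open>Closure properties of recursive functions\<close>

lemma recursive_comp_cong:
  assumes "recursive (length hs) g" "\<And>h. h \<in> set hs \<Longrightarrow> recursive k h"
    and "\<And>xs. length xs = k \<Longrightarrow> f xs = g (map (\<lambda>h. h xs) hs)"
  shows "recursive k f"
  using recursive.ext[OF recursive.comp[OF assms(1,2)]] assms(3) by blast

lemma recursive_comp1:
  assumes "recursive 1 g" "recursive k a"
  shows "recursive k (\<lambda>xs. g [a xs])"
  by (rule recursive_comp_cong[of "[a]" g]) (use assms in auto)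

lemma recursive_Suc: "recursive k a \<Longrightarrow> recursive k (\<lambda>xs. Suc (a xs))"
  using recursive_comp1[OF recursive.succ] by simp

lemma recursive_const: "recursive k (\<lambda>xs. c)"
  by (induction c) (auto intro: recursive.zero recursive_Suc)

lemma recursive_select:
  assumes "recursive (length js) f" "set js \<subseteq> {..<k}"
    and "\<And>xs. length xs = k \<Longrightarrow> g xs = f (map ((!) xs) js)"
  shows "recursive k g"
  by (rule recursive_comp_cong[of "map (\<lambda>i xs. xs ! i) js" f])
    (use assms in \<open>auto intro!: recursive.proj simp: comp_def\<close>)

lemma map_nth_upt: "length xs = n \<Longrightarrow> map ((!) xs) [j..<n] = drop j xs"
  by (auto intro!: nth_equalityI)

text \<open>By convention a bound variable is put in front of the parameters: \<open>hd ys\<close>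
  is the variable and \<open>tl ys\<close> the outer list. This moves an outer term under such a
  binder.\<close>

lemma recursive_tl: "recursive k f \<Longrightarrow> recursive (Suc k) (\<lambda>ys. f (tl ys))"
  by (rule recursive_select[of "[1..<1 + k]" f])
    (auto simp: map_nth_upt drop_Suc simp del: upt_Suc plus_1_eq_Suc)

lemma recursive_hd: "recursive (Suc k) hd"
  by (rule recursive.ext[OF recursive.proj[of 0 "Suc k"]]) (auto simp: hd_conv_nth length_Suc_conv)

lemma recursive_Cons:
  assumes "recursive (Suc k) f" "recursive k a"
  shows "recursive k (\<lambda>xs. f (a xs # xs))"
proof (rule recursive_comp_cong[of "a # map (\<lambda>i xs. xs ! i) [0..<k]" f])
  fix xs :: "nat list" assume "length xs = k"
  then have "xs = map (\<lambda>h. h xs) (map (\<lambda>i xs. xs ! i) [0..<k])"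
    by (auto intro!: nth_equalityI)
  then show "f (a xs # xs) = f (map (\<lambda>h. h xs) (a # map (\<lambda>i xs. xs ! i) [0..<k]))"
    by simp
qed (use assms in \<open>auto intro!: recursive.proj\<close>)

text \<open>\<open>recursive.prim_rec\<close> recurses on the first argument;
  \<open>recursive_Cons\<close> substitutes \<open>a xs\<close> there, so the recursion may run up
  to any recursive value.\<close>

lemma recursive_rec_nat:
  assumes g: "recursive k g"
    and h: "recursive (Suc (Suc k)) (\<lambda>ys. h (hd ys) (hd (tl ys)) (tl (tl ys)))"
    and a: "recursive k a"
  shows "recursive k (\<lambda>xs. rec_nat (g xs) (\<lambda>n y. h n y xs) (a xs))"
  using recursive_Cons[OF recursive.prim_rec[OF g, of "\<lambda>ys. h (hd ys) (hd (tl ys)) (tl (tl ys))",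
      simplified add_2_eq_Suc' One_nat_def add_Suc_right add_0_right, OF h] a]
  by simp

section \<open>Arithmetic and the pairing function\<close>

lemma recursive_add:
  assumes "recursive k a" "recursive k b"
  shows "recursive k (\<lambda>xs. a xs + b xs)"
proof -
  have "rec_nat x (\<lambda>n y. Suc y) m = m + x" for x m by (induction m) auto
  then show ?thesis
    using recursive_rec_nat[of k b "\<lambda>n y xs. Suc y" a] assms
    by (simp add: recursive_Suc recursive_tl recursive_hd)
qed

lemma recursive_mult:
  assumes "recursive k a" "recursive k b"
  shows "recursive k (\<lambda>xs. a xs * b xs)"
proof -
  have "rec_nat 0 (\<lambda>n y. y + x) m = m * x" for x m :: nat by (induction m) auto
  then show ?thesis
    using recursive_rec_nat[of k "\<lambda>xs. 0" "\<lambda>n y xs. y + b xs" a] assms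
      recursive_add[OF recursive_tl[OF recursive_hd] recursive_tl[OF recursive_tl[OF assms(2)]]]
    by (simp add: recursive.zero)
qed

lemma recursive_pred: "recursive k a \<Longrightarrow> recursive k (\<lambda>xs. a xs - 1)"
proof -
  have "rec_nat 0 (\<lambda>n y. n) m = m - 1" for m :: nat by (cases m) auto
  then show "recursive k a \<Longrightarrow> recursive k (\<lambda>xs. a xs - 1)"
    using recursive_rec_nat[of k "\<lambda>xs. 0" "\<lambda>n y xs. n" a]
    by (simp add: recursive_hd recursive.zero)
qed

lemma recursive_diff:
  assumes "recursive k a" "recursive k b"
  shows "recursive k (\<lambda>xs. a xs - b xs)"
proof -
  have "rec_nat x (\<lambda>n y. y - 1) m = x - m" for x m :: nat by (induction m) auto
  then show ?thesis
    using recursive_rec_nat[of k a "\<lambda>n y xs. y - 1" b] assms recursive_pred[OF recursive_tl[OF recursive_hd]]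
    by simp
qed

lemma recursive_power2:
  assumes "recursive k a"
  shows "recursive k (\<lambda>xs. 2 ^ a xs)"
proof -
  have "rec_nat (Suc 0) (\<lambda>n y. y + y) m = 2 ^ m" for m :: nat by (induction m) auto
  then show ?thesis
    using recursive_rec_nat[of k "\<lambda>xs. Suc 0" "\<lambda>n y xs. y + y" a] assms
    by (simp add: recursive_add recursive_tl recursive_hd recursive_const)
qed

text \<open>\<open>prod_encode (m, n)\<close> is \<open>triangle (m + n) + m\<close>, so only the
  triangular numbers need a recursion.\<close>

lemma recursive_prod_encode:
  assumes "recursive k a" "recursive k b"
  shows "recursive k (\<lambda>xs. prod_encode (a xs, b xs))"
proof -
  have "rec_nat 0 (\<lambda>n y. y + Suc n) m = triangle m" for m :: nat by (induction m) auto
  then have "recursive k (\<lambda>xs. triangle (c xs))" if "recursive k c" for c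
    using recursive_rec_nat[of k "\<lambda>xs. 0" "\<lambda>n y xs. y + Suc n" c] that
    by (simp add: recursive_add recursive_Suc recursive_tl recursive_hd recursive.zero
        del: add_Suc_right)
  then show ?thesis
    using assms by (simp add: prod_encode_def recursive_add)
qed

section \<open>Decidable predicates\<close>

text \<open>Truth is coded by 0 to fit the zero test of \<open>minimization\<close>; conjunction
  then becomes addition.\<close>

definition decidable :: "nat \<Rightarrow> (nat list \<Rightarrow> bool) \<Rightarrow> bool" where
  "decidable k P \<longleftrightarrow> recursive k (\<lambda>xs. if P xs then 0 else 1)"

lemma decidable_eq_0:
  assumes "recursive k a"
  shows "decidable k (\<lambda>xs. a xs = 0)"
proof -
  have "rec_nat 0 (\<lambda>n y. Suc 0) m = (if m = 0 then 0 else 1)" for m :: nat by (cases m) auto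
  then show ?thesis
    unfolding decidable_def
    using recursive_rec_nat[OF recursive.zero recursive_const[of _ 1] assms] by simp
qed

lemma decidable_cong:
  "decidable k P \<Longrightarrow> (\<And>xs. length xs = k \<Longrightarrow> Q xs = P xs) \<Longrightarrow> decidable k Q"
  unfolding decidable_def by (erule recursive.ext) simp

lemma decidable_const: "decidable k (\<lambda>xs. c)"
  by (cases c) (auto simp: decidable_def intro: recursive_const)

lemma decidable_le:
  assumes "recursive k a" "recursive k b"
  shows "decidable k (\<lambda>xs. a xs \<le> b xs)"
  using decidable_eq_0[OF recursive_diff[OF assms]] by simp

lemma decidable_conj:
  assumes "decidable k P" "decidable k Q"
  shows "decidable k (\<lambda>xs. P xs \<and> Q xs)"
  using decidable_eq_0[OF recursive_add[OF assms[unfolded decidable_def]]]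
  by (rule decidable_cong) auto

lemma decidable_not:
  assumes "decidable k P"
  shows "decidable k (\<lambda>xs. \<not> P xs)"
  using decidable_eq_0[OF recursive_diff[OF recursive_const[of k 1] assms[unfolded decidable_def]]]
  by (rule decidable_cong) auto

lemma decidable_imp:
  assumes "decidable k P" "decidable k Q"
  shows "decidable k (\<lambda>xs. P xs \<longrightarrow> Q xs)"
  using decidable_not[OF decidable_conj[OF assms(1) decidable_not[OF assms(2)]]]
  by (rule decidable_cong) auto

lemma decidable_eq:
  assumes "recursive k a" "recursive k b"
  shows "decidable k (\<lambda>xs. a xs = b xs)"
  using decidable_conj[OF decidable_le[OF assms] decidable_le[OF assms(2,1)]]
  by (rule decidable_cong) auto

text \<open>In a recursion the second argument is the accumulator, which a predicate on the counter
  and the parameters has to skip.\<close>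

lemma decidable_skip_snd:
  assumes "decidable (Suc k) (\<lambda>ys. P (hd ys) (tl ys))"
  shows "decidable (Suc (Suc k)) (\<lambda>ys. P (hd ys) (tl (tl ys)))"
  unfolding decidable_def
  by (rule recursive_select[of "0 # [2..<2 + k]"])
    (use assms in \<open>auto simp: decidable_def map_nth_upt drop_Suc numeral_2_eq_2 hd_conv_nth
        length_Suc_conv simp del: upt_Suc add_2_eq_Suc\<close>)

lemma decidable_ball_less:
  assumes b: "recursive k b"
    and P: "decidable (Suc k) (\<lambda>ys. P (hd ys) (tl ys))"
  shows "decidable k (\<lambda>xs. \<forall>n<b xs. P n xs)"
proof -
  \<comment> \<open>The recursion counts the counterexamples below the bound.\<close>
  let ?f = "\<lambda>xs. rec_nat 0 (\<lambda>n y. y + (if P n xs then 0 else 1)) (b xs)"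
  have P': "recursive (Suc (Suc k)) (\<lambda>ys. if P (hd ys) (tl (tl ys)) then 0 else 1)"
    using decidable_skip_snd[OF P] by (simp add: decidable_def)
  have "recursive k ?f"
    by (rule recursive_rec_nat[OF recursive.zero _ b])
      (intro recursive_add recursive_tl recursive_hd P')
  moreover have "rec_nat 0 (\<lambda>n y. y + (if P n xs then 0 else (1::nat))) m = 0 \<longleftrightarrow> (\<forall>n<m. P n xs)"
    for m xs by (induction m) (auto simp: less_Suc_eq)
  ultimately show ?thesis
    using decidable_eq_0[of k ?f] by simp
qed

lemma decidable_bex_less:
  assumes "recursive k b" "decidable (Suc k) (\<lambda>ys. P (hd ys) (tl ys))"
  shows "decidable k (\<lambda>xs. \<exists>n<b xs. P n xs)"
  using decidable_not[OF decidable_ball_less[OF assms(1), of "\<lambda>n xs. \<not> P n xs"]]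
    decidable_not[OF assms(2)] by simp

lemma recursive_Least:
  assumes "decidable (Suc k) (\<lambda>ys. P (hd ys) (tl ys))" "\<And>xs. length xs = k \<Longrightarrow> \<exists>n. P n xs"
  shows "recursive k (\<lambda>xs. LEAST n. P n xs)"
proof -
  \<comment> \<open>The redundant \<open>hd (n # xs)\<close> and \<open>tl (n # xs)\<close> give the
    body the shape \<open>g (n # xs)\<close> that the rule expects.\<close>
  have "recursive k (\<lambda>xs. LEAST n. (if P (hd (n # xs)) (tl (n # xs)) then 0 else (1::nat)) = 0)"
    by (rule recursive.minimization) (use assms in \<open>auto simp: decidable_def\<close>)
  moreover have "(if Q then 0 else (1::nat)) = 0 \<longleftrightarrow> Q" for Q by simp
  ultimately show ?thesis by simp
qed

lemma recursive_if:
  assumes "decidable k P" "recursive k a" "recursive k b"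
  shows "recursive k (\<lambda>xs. if P xs then a xs else b xs)"
proof (rule recursive.ext)
  show "recursive k (\<lambda>xs. (1 - (if P xs then 0 else 1)) * a xs + (if P xs then 0 else 1) * b xs)"
    using assms unfolding decidable_def
    by (intro recursive_add recursive_mult recursive_diff recursive_const)
qed auto

section \<open>Decoding of pairs and canonical indices of finite sets\<close>

lemma recursive_fst_prod_decode: "recursive 1 (\<lambda>xs. fst (prod_decode (xs ! 0)))"
proof -
  \<comment> \<open>The first component is found by search; the second is at most the code, which
    bounds the inner quantifier.\<close>
  have "recursive 1 (\<lambda>xs. LEAST a. \<exists>b<Suc (xs ! 0). prod_encode (a, b) = xs ! 0)"
  proof (rule recursive_Least)
    show "decidable (Suc 1) (\<lambda>ys. \<exists>b<Suc (tl ys ! 0). prod_encode (hd ys, b) = tl ys ! 0)"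
      by (intro decidable_bex_less decidable_eq recursive_prod_encode recursive_Suc recursive_hd
          recursive_tl[where f = "\<lambda>ys. ys ! 0"] recursive_tl[where f = "\<lambda>ys. tl ys ! 0"]
          recursive_tl[where f = hd] recursive.proj) simp_all
    fix xs :: "nat list"
    obtain a b where "prod_decode (xs ! 0) = (a, b)" by fastforce
    then have "prod_encode (a, b) = xs ! 0" by (metis prod_decode_inverse)
    then show "\<exists>a. \<exists>b<Suc (xs ! 0). prod_encode (a, b) = xs ! 0"
      by (metis le_imp_less_Suc le_prod_encode_2)
  qed
  moreover have "(LEAST a. \<exists>b<Suc c. prod_encode (a, b) = c) = fst (prod_decode c)" for c
  proof (rule Least_equality)
    show "\<exists>b<Suc c. prod_encode (fst (prod_decode c), b) = c"
      by (metis le_imp_less_Suc le_prod_encode_2 prod.collapse prod_decode_inverse)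
  qed auto
  ultimately show ?thesis by simp
qed

lemma recursive_snd_prod_decode: "recursive 1 (\<lambda>xs. snd (prod_decode (xs ! 0)))"
proof -
  have "recursive 1 (\<lambda>xs. LEAST b. prod_encode (fst (prod_decode (xs ! 0)), b) = xs ! 0)"
  proof (rule recursive_Least)
    show "decidable (Suc 1) (\<lambda>ys. prod_encode (fst (prod_decode (tl ys ! 0)), hd ys) = tl ys ! 0)"
      by (intro decidable_eq recursive_prod_encode recursive_hd
          recursive_tl[where f = "\<lambda>ys. ys ! 0"] recursive_tl[OF recursive_fst_prod_decode]
          recursive.proj) simp_all
    show "\<exists>b. prod_encode (fst (prod_decode (xs ! 0)), b) = xs ! 0" for xs :: "nat list"
      by (metis prod.collapse prod_decode_inverse)
  qed
  moreover have "(LEAST b. prod_encode (fst (prod_decode c), b) = c) = snd (prod_decode c)" for c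
  proof (rule Least_equality)
    show "prod_encode (fst (prod_decode c), snd (prod_decode c)) = c" by simp
  qed (metis order_refl prod_encode_inverse snd_conv)
  ultimately show ?thesis by simp
qed

lemma recursive_prod_decode:
  assumes "recursive k a"
  shows "recursive k (\<lambda>xs. fst (prod_decode (a xs)))" "recursive k (\<lambda>xs. snd (prod_decode (a xs)))"
  using recursive_comp1[OF recursive_fst_prod_decode assms]
    recursive_comp1[OF recursive_snd_prod_decode assms] by simp_all

text \<open>A set bit \<open>c\<close> forces \<open>2 ^ c \<le> v\<close>, and
  \<open>c < 2 ^ c\<close>. Quantifiers over \<open>set_decode v\<close> can therefore be bounded by
  \<open>v\<close>.\<close>

lemma mem_set_decode_less: "c \<in> set_decode v \<Longrightarrow> c < v"
proof -
  assume "c \<in> set_decode v"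
  then have "v div 2 ^ c \<noteq> 0" by (auto simp: set_decode_def intro!: Nat.gr0I)
  then have "2 ^ c \<le> v" by (metis div_less not_le)
  then show "c < v" by (meson less_exp less_le_trans)
qed

text \<open>Membership says that \<open>v div 2 ^ c\<close> is odd. Taking half the quotient and the
  remainder as bounded witnesses leaves only operations already known to be recursive.\<close>

lemma mem_set_decode_iff:
  "c \<in> set_decode v \<longleftrightarrow> (\<exists>q<Suc v. \<exists>s<2 ^ c. v = (q + q + 1) * 2 ^ c + s)"
proof
  assume "c \<in> set_decode v"
  then obtain q where q: "v div 2 ^ c = q + q + 1"
    by (auto simp: set_decode_def mult_2 elim!: oddE)
  have "q \<le> v div 2 ^ c" using q by simp
  also have "\<dots> \<le> v" by simp
  finally have "q < Suc v" by simp
  moreover have "v = (q + q + 1) * 2 ^ c + v mod 2 ^ c" using q by (metis div_mult_mod_eq)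
  ultimately show "\<exists>q<Suc v. \<exists>s<2 ^ c. v = (q + q + 1) * 2 ^ c + s"
    by (metis mod_less_divisor zero_less_numeral zero_less_power)
next
  assume "\<exists>q<Suc v. \<exists>s<2 ^ c. v = (q + q + 1) * 2 ^ c + s"
  then obtain q s where "s < 2 ^ c" "v = s + (q + q + 1) * 2 ^ c" by (auto simp: add.commute)
  then have "v div 2 ^ c = q + q + 1" by (simp only: div_mult_self1 div_less)
  then show "c \<in> set_decode v" by (simp add: set_decode_def)
qed

lemma decidable_mem_set_decode:
  assumes "recursive k a" "recursive k b"
  shows "decidable k (\<lambda>xs. a xs \<in> set_decode (b xs))"
  unfolding mem_set_decode_iff
  by (intro decidable_bex_less decidable_eq recursive_add recursive_mult recursive_Suc
      recursive_power2 recursive_const recursive_hd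
      recursive_tl[where f = a] recursive_tl[where f = b] recursive_tl[where f = hd]
      recursive_tl[where f = "\<lambda>ys. a (tl ys)"] recursive_tl[where f = "\<lambda>ys. b (tl ys)"] assms)


text \<open>Here \<open>js\<close> is fixed, independent of the input, so the quantifier is a finite
  conjunction and each \<open>P i\<close> may have its own decision function.\<close>

lemma decidable_ball_set:
  assumes "\<And>i. i \<in> set js \<Longrightarrow> decidable k (P i)"
  shows "decidable k (\<lambda>xs. \<forall>i\<in>set js. P i xs)"
  using assms by (induction js) (auto intro: decidable_const decidable_conj)

section \<open>Semidecidable predicates and recursively enumerable sets\<close>

text \<open>The existential form of enumerability, in which closure under logical connectives is
  easy to prove; \<open>rec_enumerable_iff_semidecidable\<close> links the two forms.\<close>

definition semidecidable :: "nat \<Rightarrow> (nat list \<Rightarrow> bool) \<Rightarrow> bool" where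
  "semidecidable k P \<longleftrightarrow> (\<exists>R. decidable (Suc k) (\<lambda>ys. R (hd ys) (tl ys)) \<and>
     (\<forall>xs. length xs = k \<longrightarrow> P xs \<longleftrightarrow> (\<exists>t. R t xs)))"

lemma semidecidableI:
  assumes "decidable (Suc k) (\<lambda>ys. R (hd ys) (tl ys))"
    and "\<And>xs. length xs = k \<Longrightarrow> P xs \<longleftrightarrow> (\<exists>t. R t xs)"
  shows "semidecidable k P"
  using assms unfolding semidecidable_def by blast

lemma semidecidableE:
  assumes "semidecidable k P"
  obtains R where "decidable (Suc k) (\<lambda>ys. R (hd ys) (tl ys))"
    and "\<And>xs. length xs = k \<Longrightarrow> P xs \<longleftrightarrow> (\<exists>t. R t xs)"
  using assms unfolding semidecidable_def by blast

lemma semidecidable_cong: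
  "semidecidable k P \<Longrightarrow> (\<And>xs. length xs = k \<Longrightarrow> Q xs = P xs) \<Longrightarrow> semidecidable k Q"
  by (simp add: semidecidable_def)

lemma decidable_tl: "decidable k P \<Longrightarrow> decidable (Suc k) (\<lambda>ys. P (tl ys))"
  unfolding decidable_def by (rule recursive_tl)

lemma decidable_imp_semidecidable: "decidable k P \<Longrightarrow> semidecidable k P"
  by (rule semidecidableI[where R = "\<lambda>t. P"]) (auto intro: decidable_tl)

lemma semidecidable_conj:
  assumes "semidecidable k P" "semidecidable k Q"
  shows "semidecidable k (\<lambda>xs. P xs \<and> Q xs)"
proof -
  obtain R where R: "decidable (Suc k) (\<lambda>ys. R (hd ys) (tl ys))"
    "\<And>xs. length xs = k \<Longrightarrow> P xs \<longleftrightarrow> (\<exists>t. R t xs)" using semidecidableE[OF assms(1)] by blast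
  obtain R' where R': "decidable (Suc k) (\<lambda>ys. R' (hd ys) (tl ys))"
    "\<And>xs. length xs = k \<Longrightarrow> Q xs \<longleftrightarrow> (\<exists>t. R' t xs)" using semidecidableE[OF assms(2)] by blast
  show ?thesis
  \<comment> \<open>A common bound \<open>N\<close> for both searches serves as the single witness,
    which avoids coding pairs.\<close>
  proof (rule semidecidableI[where R = "\<lambda>N xs. (\<exists>t<N. R t xs) \<and> (\<exists>t<N. R' t xs)"])
    show "decidable (Suc k) (\<lambda>ys. (\<exists>t<hd ys. R t (tl ys)) \<and> (\<exists>t<hd ys. R' t (tl ys)))"
      by (intro decidable_conj decidable_bex_less recursive_hd decidable_skip_snd R(1) R'(1))
    fix xs :: "nat list" assume "length xs = k"
    moreover have "\<exists>N. (\<exists>t<N. R t xs) \<and> (\<exists>t<N. R' t xs)" if "R s xs" "R' s' xs" for s s'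
      using that by (intro exI[of _ "Suc (max s s')"]) (auto simp: less_Suc_eq_le le_max_iff_disj)
    ultimately show "P xs \<and> Q xs \<longleftrightarrow> (\<exists>N. (\<exists>t<N. R t xs) \<and> (\<exists>t<N. R' t xs))"
      using R(2) R'(2) by blast
  qed
qed

lemma semidecidable_imp:
  assumes "decidable k Q" "semidecidable k P"
  shows "semidecidable k (\<lambda>xs. Q xs \<longrightarrow> P xs)"
proof -
  obtain R where R: "decidable (Suc k) (\<lambda>ys. R (hd ys) (tl ys))"
    "\<And>xs. length xs = k \<Longrightarrow> P xs \<longleftrightarrow> (\<exists>t. R t xs)" using semidecidableE[OF assms(2)] by blast
  show ?thesis
    by (rule semidecidableI[where R = "\<lambda>t xs. Q xs \<longrightarrow> R t xs"])
      (use R assms(1) in \<open>auto intro: decidable_imp decidable_tl\<close>)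
qed

text \<open>The full list reads \<open>t\<close>, \<open>n\<close>, \<open>N\<close>, parameters;
  the bound \<open>N\<close> at position 2 has to be hidden from \<open>R\<close>. Both quantifier
  lemmas below search for witnesses of \<open>R\<close> under such an \<open>N\<close>.\<close>

lemma decidable_bex_skip_third:
  assumes "decidable (Suc (Suc k)) (\<lambda>ys. R (hd ys) (tl ys))"
  shows "decidable (Suc (Suc k)) (\<lambda>zs. \<exists>t<hd (tl zs). R t (hd zs # tl (tl zs)))"
proof (rule decidable_bex_less)
  show "decidable (Suc (Suc (Suc k))) (\<lambda>zs. R (hd zs) (hd (tl zs) # tl (tl (tl zs))))"
    unfolding decidable_def
    by (rule recursive_select[of "0 # 1 # [3..<3 + k]"])
      (use assms in \<open>auto simp: decidable_def map_nth_upt drop_Suc numeral_3_eq_3 hd_conv_nth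
          length_Suc_conv simp del: upt_Suc\<close>)
qed (intro recursive_tl recursive_hd)

lemma semidecidable_ex:
  assumes "semidecidable (Suc k) (\<lambda>ys. P (hd ys) (tl ys))"
  shows "semidecidable k (\<lambda>xs. \<exists>n. P n xs)"
proof -
  obtain R where R: "decidable (Suc (Suc k)) (\<lambda>ys. R (hd ys) (tl ys))"
    "\<And>ys. length ys = Suc k \<Longrightarrow> P (hd ys) (tl ys) \<longleftrightarrow> (\<exists>t. R t ys)"
    using semidecidableE[OF assms] by blast
  show ?thesis
  proof (rule semidecidableI[where R = "\<lambda>N xs. \<exists>n<N. \<exists>t<N. R t (n # xs)"])
    show "decidable (Suc k) (\<lambda>ys. \<exists>n<hd ys. \<exists>t<hd ys. R t (n # tl ys))"
      by (intro decidable_bex_less[where b = hd] recursive_hd decidable_bex_skip_third R(1))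
    fix xs :: "nat list" assume "length xs = k"
    then have "P n xs \<longleftrightarrow> (\<exists>t. R t (n # xs))" for n
      using R(2)[of "n # xs"] by simp
    moreover have "\<exists>N. \<exists>n<N. \<exists>t<N. R t (n # xs)" if "R s (m # xs)" for s m
      using that by (intro exI[of _ "Suc (max s m)"] exI[of _ m] exI[of _ s] conjI) auto
    ultimately show "(\<exists>n. P n xs) \<longleftrightarrow> (\<exists>N. \<exists>n<N. \<exists>t<N. R t (n # xs))"
      by blast
  qed
qed

text \<open>Collection: finitely many witnesses, one for each \<open>n\<close> below
  \<open>b xs\<close>, have a common upper bound, so the unbounded quantifier moves outside.\<close>

lemma semidecidable_ball_less:
  assumes "recursive k b" "semidecidable (Suc k) (\<lambda>ys. P (hd ys) (tl ys))"
  shows "semidecidable k (\<lambda>xs. \<forall>n<b xs. P n xs)"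
proof -
  obtain R where R: "decidable (Suc (Suc k)) (\<lambda>ys. R (hd ys) (tl ys))"
    "\<And>ys. length ys = Suc k \<Longrightarrow> P (hd ys) (tl ys) \<longleftrightarrow> (\<exists>t. R t ys)"
    using semidecidableE[OF assms(2)] by blast
  show ?thesis
  proof (rule semidecidableI[where R = "\<lambda>N xs. \<forall>n<b xs. \<exists>t<N. R t (n # xs)"])
    show "decidable (Suc k) (\<lambda>ys. \<forall>n<b (tl ys). \<exists>t<hd ys. R t (n # tl ys))"
      by (intro decidable_ball_less[where b = "\<lambda>ys. b (tl ys)"] recursive_tl
          decidable_bex_skip_third R(1) assms(1))
    fix xs :: "nat list" assume "length xs = k"
    then have P: "P n xs \<longleftrightarrow> (\<exists>t. R t (n # xs))" for n
      using R(2)[of "n # xs"] by simp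
    show "(\<forall>n<b xs. P n xs) \<longleftrightarrow> (\<exists>N. \<forall>n<b xs. \<exists>t<N. R t (n # xs))"
    proof
      assume "\<forall>n<b xs. P n xs"
      then obtain s where s: "\<And>n. n < b xs \<Longrightarrow> R (s n) (n # xs)" using P by metis
      have "s n < Suc (Max (s ` {..<b xs}))" if "n < b xs" for n
        using that by (auto simp: less_Suc_eq_le intro!: Max_ge)
      then show "\<exists>N. \<forall>n<b xs. \<exists>t<N. R t (n # xs)" using s by blast
    qed (use P in blast)
  qed
qed

lemma semidecidable_comp:
  assumes "semidecidable (length hs) P" "\<And>h. h \<in> set hs \<Longrightarrow> recursive k h"
    and "\<And>xs. length xs = k \<Longrightarrow> Q xs = P (map (\<lambda>h. h xs) hs)"
  shows "semidecidable k Q"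
proof -
  obtain R where R: "decidable (Suc (length hs)) (\<lambda>ys. R (hd ys) (tl ys))"
    "\<And>ys. length ys = length hs \<Longrightarrow> P ys \<longleftrightarrow> (\<exists>t. R t ys)"
    using semidecidableE[OF assms(1)] by blast
  show ?thesis
  proof (rule semidecidableI[where R = "\<lambda>t xs. R t (map (\<lambda>h. h xs) hs)"])
    show "decidable (Suc k) (\<lambda>ys. R (hd ys) (map (\<lambda>h. h (tl ys)) hs))"
      unfolding decidable_def
      by (rule recursive_comp_cong[of "hd # map (\<lambda>h ys. h (tl ys)) hs"])
        (use R(1) assms(2) in \<open>auto simp: decidable_def comp_def intro!: recursive_hd recursive_tl\<close>)
  qed (use R(2) assms(3) in auto)
qed

section \<open>Coding of tuples and the equivalence with enumerability\<close>

fun tuple_decode :: "nat \<Rightarrow> nat \<Rightarrow> nat list" where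
  "tuple_decode 0 c = []"
| "tuple_decode (Suc k) c = fst (prod_decode c) # tuple_decode k (snd (prod_decode c))"

lemma length_tuple_decode [simp]: "length (tuple_decode k c) = k"
  by (induction k arbitrary: c) auto

lemma tuple_decode_surj: "length xs = k \<Longrightarrow> \<exists>c. tuple_decode k c = xs"
proof (induction k arbitrary: xs)
  case (Suc k)
  then obtain x ys where "xs = x # ys" "length ys = k" by (auto simp: length_Suc_conv)
  moreover obtain c where "tuple_decode k c = ys" using Suc.IH \<open>length ys = k\<close> by blast
  ultimately have "tuple_decode (Suc k) (prod_encode (x, c)) = xs" by simp
  then show ?case by blast
qed auto

lemma recursive_tuple_decode_nth:
  "recursive n a \<Longrightarrow> i < k \<Longrightarrow> recursive n (\<lambda>xs. tuple_decode k (a xs) ! i)"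
proof (induction k arbitrary: a i)
  case (Suc k)
  then show ?case by (cases i) (auto intro: recursive_prod_decode)
qed simp

text \<open>A stage \<open>t\<close> of an enumeration is a witness for membership. Conversely, run
  through all codes of a witness followed by a tuple; output the tuple if the witness is valid and a
  fixed member of \<open>A\<close> otherwise.\<close>

lemma rec_enumerable_iff_semidecidable:
  assumes len: "\<And>xs. xs \<in> A \<Longrightarrow> length xs = k"
  shows "rec_enumerable k A \<longleftrightarrow> semidecidable k (\<lambda>xs. xs \<in> A)"
proof
  assume "rec_enumerable k A"
  then consider "A = {}" | fs where "length fs = k" "\<forall>f\<in>set fs. recursive 1 f"
    "A = range (\<lambda>t. map (\<lambda>f. f [t]) fs)"
    unfolding rec_enumerable_def by blast
  then show "semidecidable k (\<lambda>xs. xs \<in> A)"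
  proof cases
    case 1
    then show ?thesis by (simp add: decidable_imp_semidecidable decidable_const)
  next
    case 2
    show ?thesis
    proof (rule semidecidableI[where R = "\<lambda>t xs. \<forall>i\<in>set [0..<k]. xs ! i = (fs ! i) [t]"])
      show "decidable (Suc k) (\<lambda>ys. \<forall>i\<in>set [0..<k]. tl ys ! i = (fs ! i) [hd ys])"
        by (rule decidable_ball_set, rule decidable_eq)
          (use 2 in \<open>auto intro!: recursive_comp1 recursive_hd recursive_tl recursive.proj\<close>)
      show "xs \<in> A \<longleftrightarrow> (\<exists>t. \<forall>i\<in>set [0..<k]. xs ! i = (fs ! i) [t])" if "length xs = k" for xs
      proof -
        have "xs = map (\<lambda>f. f [t]) fs \<longleftrightarrow> (\<forall>i\<in>set [0..<k]. xs ! i = (fs ! i) [t])" for t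
          unfolding list_eq_iff_nth_eq using that 2(1) by (simp add: Ball_def)
        then show ?thesis unfolding 2(3) by blast
      qed
    qed
  qed
next
  assume "semidecidable k (\<lambda>xs. xs \<in> A)"
  then obtain R where R: "decidable (Suc k) (\<lambda>ys. R (hd ys) (tl ys))"
    "\<And>xs. length xs = k \<Longrightarrow> xs \<in> A \<longleftrightarrow> (\<exists>t. R t xs)"
    using semidecidableE by blast
  show "rec_enumerable k A"
  proof (cases "A = {}")
    case False
    then obtain a where a: "a \<in> A" by blast
    let ?z = "tuple_decode (Suc k)"
    \<comment> \<open>Component \<open>i\<close> of the enumeration: entry 0 of the decoded list is
      the witness, hence \<open>Suc i\<close>; \<open>a\<close> is the default output.\<close>
    let ?g = "\<lambda>i xs. if R (hd (?z (xs ! 0))) (tl (?z (xs ! 0))) then ?z (xs ! 0) ! Suc i else a ! i"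
    have dec: "decidable 1 (\<lambda>xs. R (hd (?z (xs ! 0))) (tl (?z (xs ! 0))))"
      unfolding decidable_def
    \<comment> \<open>Composition takes a list of component functions, so the decoded list is
      reassembled from its entries.\<close>
    proof (rule recursive_comp_cong[of "map (\<lambda>i xs. ?z (xs ! 0) ! i) [0..<Suc k]"])
      show "recursive (length (map (\<lambda>i xs. ?z (xs ! 0) ! i) [0..<Suc k]))
          (\<lambda>ys. if R (hd ys) (tl ys) then 0 else 1)"
        using R(1) by (simp add: decidable_def)
      have "?z c = map (\<lambda>i. ?z c ! i) [0..<Suc k]" for c
        by (metis length_tuple_decode map_nth)
      then have "?z (xs ! 0) = map (\<lambda>h. h xs) (map (\<lambda>i xs. ?z (xs ! 0) ! i) [0..<Suc k])"
        for xs :: "nat list" by (simp only: map_map comp_def)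
      then show "(if R (hd (?z (xs ! 0))) (tl (?z (xs ! 0))) then 0 else 1) =
          (\<lambda>ys. if R (hd ys) (tl ys) then 0 else (1::nat))
            (map (\<lambda>h. h xs) (map (\<lambda>i xs. ?z (xs ! 0) ! i) [0..<Suc k]))" for xs :: "nat list"
        by metis
    qed (auto intro!: recursive_tuple_decode_nth recursive.proj simp del: tuple_decode.simps upt_Suc)
    have g: "recursive 1 (?g i)" if "i < k" for i
      by (intro recursive_if dec recursive_tuple_decode_nth recursive.proj recursive_const)
        (use that in auto)
    have "(if R (hd (?z t)) (tl (?z t)) then tl (?z t) else a) = map (\<lambda>f. f [t]) (map ?g [0..<k])"
      for t
      using len[OF a] by (auto intro!: nth_equalityI)
    moreover have "A = range (\<lambda>t. if R (hd (?z t)) (tl (?z t)) then tl (?z t) else a)"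
    proof (intro subset_antisym subsetI)
      fix xs assume "xs \<in> A"
      then obtain t where t: "R t xs" "length xs = k" using R(2) len by blast
      then obtain c where "?z c = t # xs" using tuple_decode_surj[of "t # xs" "Suc k"] by auto
      then show "xs \<in> range (\<lambda>t. if R (hd (?z t)) (tl (?z t)) then tl (?z t) else a)"
        using t by (intro range_eqI[of _ _ c]) (simp del: tuple_decode.simps)
    qed (use a R(2) in \<open>auto split: if_splits\<close>)
    ultimately show ?thesis
      unfolding rec_enumerable_def
      by (intro disjI2 exI[of _ "map ?g [0..<k]"]) (use g in auto)
  qed (simp add: rec_enumerable_def)
qed

lemma semidecidable_rec_enumerable2:
  assumes "rec_enumerable2 A" "recursive k a" "recursive k b"
  shows "semidecidable k (\<lambda>xs. (a xs, b xs) \<in> A)"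
proof (rule semidecidable_comp[of "[a, b]"])
  show "semidecidable (length [a, b]) (\<lambda>ys. ys \<in> {[a, b] | a b. (a, b) \<in> A})"
    using assms(1) unfolding rec_enumerable2_def
    by (subst (asm) rec_enumerable_iff_semidecidable) (auto simp: numeral_2_eq_2)
qed (use assms in auto)

lemma semidecidable_rec_enumerable4:
  assumes "rec_enumerable4 A" "recursive k a" "recursive k b" "recursive k c" "recursive k d"
  shows "semidecidable k (\<lambda>xs. (a xs, b xs, c xs, d xs) \<in> A)"
proof (rule semidecidable_comp[of "[a, b, c, d]"])
  show "semidecidable (length [a, b, c, d]) (\<lambda>ys. ys \<in> {[a, b, c, d] | a b c d. (a, b, c, d) \<in> A})"
    using assms(1) unfolding rec_enumerable4_def
    by (subst (asm) rec_enumerable_iff_semidecidable) (auto simp: eval_nat_numeral)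
qed (use assms in auto)

lemma rec_enumerable4I:
  assumes "semidecidable 4 (\<lambda>xs. (xs ! 0, xs ! 1, xs ! 2, xs ! 3) \<in> A)"
  shows "rec_enumerable4 A"
proof -
  have "xs \<in> {[a, b, c, d] | a b c d. (a, b, c, d) \<in> A} \<longleftrightarrow> (xs ! 0, xs ! 1, xs ! 2, xs ! 3) \<in> A"
    if "length xs = 4" for xs
    using that by (auto simp: length_Suc_conv eval_nat_numeral)
  then have "semidecidable 4 (\<lambda>xs. xs \<in> {[a, b, c, d] | a b c d. (a, b, c, d) \<in> A})"
    by (rule semidecidable_cong[OF assms])
  then show ?thesis
    unfolding rec_enumerable4_def by (subst rec_enumerable_iff_semidecidable) auto
qed

section \<open>The approximation system\<close>

text \<open>The finite sets used by \<open>W\<close> are arbitrary; only those that are graphs of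
  partial functions can be extended to the graph of a name.\<close>

definition functional_code :: "nat \<Rightarrow> bool" where
  "functional_code v \<longleftrightarrow> (\<forall>c\<in>set_decode v. \<forall>c'\<in>set_decode v.
     fst (prod_decode c) = fst (prod_decode c') \<longrightarrow> c = c')"

lemma decidable_functional_code:
  assumes "recursive k a"
  shows "decidable k (\<lambda>xs. functional_code (a xs))"
proof (rule decidable_cong)
  show "decidable k (\<lambda>xs. \<forall>c<a xs. \<forall>c'<a xs. c \<in> set_decode (a xs) \<longrightarrow> c' \<in> set_decode (a xs) \<longrightarrow>
      fst (prod_decode c) = fst (prod_decode c') \<longrightarrow> c = c')"
    by (intro decidable_ball_less decidable_imp decidable_eq decidable_mem_set_decode
        recursive_prod_decode recursive_hd recursive_tl[where f = hd] recursive_tl[where f = a]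
        recursive_tl[where f = "\<lambda>ys. a (tl ys)"] assms)
qed (use mem_set_decode_less in \<open>auto simp: functional_code_def\<close>)

text \<open>By the triangle inequality this puts the ball of radius \<open>r t\<close> about
  \<open>\<gamma> j\<close> inside the ball of radius \<open>r s\<close> about
  \<open>\<gamma> i\<close>.\<close>

definition dist_below ::
  "('a \<Rightarrow> 'a \<Rightarrow> real) \<Rightarrow> (nat \<rightharpoonup> 'a) \<Rightarrow> (nat \<Rightarrow> rat) \<Rightarrow> nat \<Rightarrow> nat \<Rightarrow> nat \<Rightarrow> nat \<Rightarrow> bool" where
  "dist_below \<rho> \<gamma> r i j s t \<longleftrightarrow> i \<in> dom \<gamma> \<and> j \<in> dom \<gamma> \<and>
     \<rho> (the (\<gamma> i)) (the (\<gamma> j)) < of_rat (r s) - of_rat (r t)"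

text \<open>Truncated subtraction is harmless: the set in \<^const>\<open>semi_computable_metric_space\<close> excludes a
  vanishing numerator.\<close>

lemma less_fraction_diff_iff:
  fixes x :: real and a b a' b' :: nat
  assumes "0 \<le> x" "0 < b" "0 < b'"
  shows "a * b' - a' * b \<noteq> 0 \<and> b * b' \<noteq> 0 \<and> x < real (a * b' - a' * b) / real (b * b') \<longleftrightarrow>
    x < real a / real b - real a' / real b'"
proof -
  have eq: "real a / real b - real a' / real b' = (real (a * b') - real (a' * b)) / real (b * b')"
    using assms by (simp add: field_simps)
  show ?thesis
  proof (cases "a' * b < a * b'")
    case True
    then show ?thesis using assms unfolding eq by (simp add: of_nat_diff)
  next
    case False
    then have "real (a * b') - real (a' * b) \<le> 0" by (simp only: of_nat_le_iff diff_le_0_iff_le not_less)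
    then have "(real (a * b') - real (a' * b)) / real (b * b') \<le> 0"
      using assms by (simp add: divide_le_0_iff)
    then show ?thesis using False assms unfolding eq by auto
  qed
qed

lemma semidecidable_dist_below:
  assumes "semi_computable_metric_space Z \<rho> \<gamma>" "computable_pos_rat_seq r"
    and "recursive k i" "recursive k j" "recursive k s" "recursive k t"
  shows "semidecidable k (\<lambda>xs. dist_below \<rho> \<gamma> r (i xs) (j xs) (s xs) (t xs))"
proof -
  interpret Metric_space Z \<rho> using assms(1) by (simp add: semi_computable_metric_space_def)
  obtain p q where pq: "recursive 1 p" "recursive 1 q"
    "\<And>n. p [n] > 0" "\<And>n. q [n] > 0" "\<And>n. r n = of_nat (p [n]) / of_nat (q [n])"
    using assms(2) unfolding computable_pos_rat_seq_def by blast
  let ?A = "{(l, l', p, q). l \<in> dom \<gamma> \<and> l' \<in> dom \<gamma> \<and> p \<noteq> 0 \<and> q \<noteq> 0 \<and>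
      \<rho> (the (\<gamma> l)) (the (\<gamma> l')) < real p / real q}"
  have A: "rec_enumerable4 ?A" using assms(1) by (simp add: semi_computable_metric_space_def)
  \<comment> \<open>Over a common denominator the difference of the radii is one fraction, so a
    single query to the enumerable set \<open>?A\<close> suffices.\<close>
  have "dist_below \<rho> \<gamma> r i j s t \<longleftrightarrow> (i, j, p [s] * q [t] - p [t] * q [s], q [s] * q [t]) \<in> ?A"
    for i j s t
    using less_fraction_diff_iff[of "\<rho> (the (\<gamma> i)) (the (\<gamma> j))" "q [s]" "q [t]" "p [s]" "p [t]"] pq(4)
    by (simp add: dist_below_def pq(5) of_rat_divide not_le)
  then show ?thesis
    by (simp only:) (intro semidecidable_rec_enumerable4[OF A] recursive_diff recursive_mult
        recursive_comp1 pq(1,2) assms(3-6))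
qed

text \<open>An index is in the domain iff its point has distance less than 1/1 from itself. This
  covers tuples whose \<open>v\<close> codes the empty set, where no distance condition forces
  \<open>k\<close> into the domain.\<close>

lemma semidecidable_dom:
  assumes "semi_computable_metric_space Z \<rho> \<gamma>" "recursive k i"
  shows "semidecidable k (\<lambda>xs. i xs \<in> dom \<gamma>)"
proof -
  interpret Metric_space Z \<rho> using assms(1) by (simp add: semi_computable_metric_space_def)
  let ?A = "{(l, l', p, q). l \<in> dom \<gamma> \<and> l' \<in> dom \<gamma> \<and> p \<noteq> 0 \<and> q \<noteq> 0 \<and>
      \<rho> (the (\<gamma> l)) (the (\<gamma> l')) < real p / real q}"
  have A: "rec_enumerable4 ?A" using assms(1) by (simp add: semi_computable_metric_space_def)
  have "the (\<gamma> i) \<in> Z" if "i \<in> dom \<gamma>" for i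
    using that assms(1) by (auto simp: semi_computable_metric_space_def ran_def)
  then have "\<rho> (the (\<gamma> i)) (the (\<gamma> i)) = 0" if "i \<in> dom \<gamma>" for i
    using that by simp
  then have dom_iff: "i \<in> dom \<gamma> \<longleftrightarrow> (i, i, 1, 1) \<in> ?A" for i by fastforce
  have "semidecidable k (\<lambda>xs. (i xs, i xs, 1, 1) \<in> ?A)"
    by (intro semidecidable_rec_enumerable4[OF A] recursive_const assms(2))
  then show ?thesis by (rule semidecidable_cong) (rule dom_iff)
qed

lemma semi_computable_metric_space_dense:
  assumes "semi_computable_metric_space Z \<rho> \<gamma>" "z \<in> Z" "0 < \<epsilon>"
  obtains i where "i \<in> dom \<gamma>" "\<rho> (the (\<gamma> i)) z < \<epsilon>"
proof -
  interpret Metric_space Z \<rho> using assms(1) by (simp add: semi_computable_metric_space_def)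
  have "z \<in> mtopology closure_of ran \<gamma>" using assms by (simp add: semi_computable_metric_space_def)
  then obtain y where "y \<in> ran \<gamma>" "y \<in> mball z \<epsilon>"
    using assms(3) by (auto simp: metric_closure_of)
  moreover from this obtain i where "\<gamma> i = Some y" by (auto simp: ran_def)
  ultimately show ?thesis using that[of i] commute[of y z] by auto
qed

text \<open>The finite function coded by \<open>v\<close> extends to a name of every point of the ball of radius
  \<open>r m\<close> about \<open>\<alpha> k\<close>. The output \<open>l\<^sub>0\<close> is taken at a finer precision \<open>n'\<close>, and every \<open>l\<close>
  close enough to it is accepted; saturation would fail without this slack, as equality of
  \<open>\<beta> l\<close> and \<open>\<beta> l\<^sub>0\<close> is not semidecidable.\<close>

definition operator_system ::
  "('a \<Rightarrow> 'a \<Rightarrow> real) \<Rightarrow> ('b \<Rightarrow> 'b \<Rightarrow> real) \<Rightarrow> (nat \<rightharpoonup> 'a) \<Rightarrow> (nat \<rightharpoonup> 'b) \<Rightarrow> (nat \<Rightarrow> rat) \<Rightarrow>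
   (nat \<times> nat) set \<Rightarrow> (nat \<times> nat \<times> nat \<times> nat) set" where
  "operator_system d e \<alpha> \<beta> r W = {(k, m, l, n). k \<in> dom \<alpha> \<and> (\<exists>n' l\<^sub>0 v.
     (prod_encode (n', l\<^sub>0), v) \<in> W \<and> functional_code v \<and>
     (\<forall>c<v. c \<in> set_decode v \<longrightarrow>
        dist_below d \<alpha> r (snd (prod_decode c)) k (fst (prod_decode c)) m) \<and>
     dist_below e \<beta> r l\<^sub>0 l n n')}"

text \<open>The depths match the binders of \<open>operator_system\<close>: the tuple lies under
  \<open>n'\<close>, \<open>l\<^sub>0\<close> and \<open>v\<close>, and under \<open>c\<close> as
  well inside the bounded quantifier.\<close>

lemmas recursive_tl_nth =
  recursive_tl[OF recursive_tl[OF recursive_tl[OF recursive.proj]]]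
  recursive_tl[OF recursive_tl[OF recursive_tl[OF recursive_tl[OF recursive.proj]]]]

lemmas recursive_hd_tl =
  recursive_hd recursive_tl[OF recursive_hd] recursive_tl[OF recursive_tl[OF recursive_hd]]

text \<open>Every conjunct is semidecidable: the universal quantifier is bounded by
  \<open>v\<close>, and the premise of its implication is decidable.\<close>

lemma rec_enumerable4_operator_system:
  assumes "semi_computable_metric_space X d \<alpha>" "semi_computable_metric_space Y e \<beta>"
    and "computable_pos_rat_seq r" "rec_enumerable2 W"
  shows "rec_enumerable4 (operator_system d e \<alpha> \<beta> r W)"
proof (rule rec_enumerable4I, unfold operator_system_def mem_Collect_eq prod.case)
  show "semidecidable 4 (\<lambda>xs. xs ! 0 \<in> dom \<alpha> \<and> (\<exists>n' l\<^sub>0 v.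
     (prod_encode (n', l\<^sub>0), v) \<in> W \<and> functional_code v \<and>
     (\<forall>c<v. c \<in> set_decode v \<longrightarrow>
        dist_below d \<alpha> r (snd (prod_decode c)) (xs ! 0) (fst (prod_decode c)) (xs ! 1)) \<and>
     dist_below e \<beta> r l\<^sub>0 (xs ! 2) (xs ! 3) n'))"
    by (intro semidecidable_conj semidecidable_ex semidecidable_ball_less semidecidable_imp
        semidecidable_dom[OF assms(1)] semidecidable_dist_below[OF assms(1,3)]
        semidecidable_dist_below[OF assms(2,3)] semidecidable_rec_enumerable2[OF assms(4)]
        decidable_imp_semidecidable[OF decidable_functional_code] decidable_mem_set_decode
        recursive_prod_encode recursive_prod_decode recursive_tl_nth recursive_hd_tl recursive.proj)
      simp_all
qed

lemma dist_below_cong: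
  assumes "\<gamma> j' = \<gamma> j"
  shows "dist_below \<rho> \<gamma> r i j' s t \<longleftrightarrow> dist_below \<rho> \<gamma> r i j s t"
  using assms by (simp add: dist_below_def dom_def)

text \<open>Apart from \<open>k \<in> dom \<alpha>\<close>, the indices \<open>k\<close> and
  \<open>l\<close> enter only as the second index of \<open>dist_below\<close>, hence only through
  \<open>\<alpha> k\<close> and \<open>\<beta> l\<close>.\<close>

lemma saturated_operator_system: "saturated \<alpha> \<beta> (operator_system d e \<alpha> \<beta> r W)"
  unfolding saturated_def
proof (intro allI impI, elim conjE)
  fix k m l n k' l'
  assume "(k, m, l, n) \<in> operator_system d e \<alpha> \<beta> r W" "k' \<in> dom \<alpha>" "\<alpha> k' = \<alpha> k" "\<beta> l' = \<beta> l"
  then show "(k', m, l', n) \<in> operator_system d e \<alpha> \<beta> r W"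
    unfolding operator_system_def mem_Collect_eq prod.case
    by (simp only: dist_below_cong[of \<alpha> k' k] dist_below_cong[of \<beta> l' l])
qed

section \<open>Correctness of the approximation system\<close>

lemma seq_accumulation_point_0_less:
  assumes "seq_accumulation_point r 0" "0 < (\<epsilon>::real)"
  obtains n where "of_rat (r n) < \<epsilon>"
proof -
  obtain \<delta> where \<delta>: "0 < \<delta>" "of_rat \<delta> < \<epsilon>"
    using of_rat_dense[OF assms(2)] by auto
  then obtain n where "\<bar>r n - 0\<bar> < \<delta>"
    using assms(1) frequently_ex unfolding seq_accumulation_point_def by blast
  then have "(of_rat (r n) :: real) < of_rat \<delta>" by (simp add: of_rat_less)
  then show ?thesis using that \<delta>(2) less_trans by blast
qed

lemma computable_pos_rat_seq_pos: "computable_pos_rat_seq r \<Longrightarrow> 0 < r n"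
  unfolding computable_pos_rat_seq_def by (elim exE conjE) simp

lemma approximation_system_operator_system:
  assumes "E \<subseteq> X" "f \<in> E \<rightarrow> Y"
    and r: "computable_pos_rat_seq r" "seq_accumulation_point r 0"
    and X: "semi_computable_metric_space X d \<alpha>"
    and Y: "semi_computable_metric_space Y e \<beta>"
    and W: "\<And>\<phi>. coded_graph (F \<phi>) = enumeration_op W (coded_graph \<phi>)"
    and F: "\<And>x u. x \<in> E \<Longrightarrow> is_name d \<alpha> r x u \<Longrightarrow>
      \<exists>v. F (Some \<circ> u) = Some \<circ> v \<and> is_name e \<beta> r (f x) v"
  shows "approximation_system d e \<alpha> \<beta> r E f (operator_system d e \<alpha> \<beta> r W)"
proof -
  interpret X: Metric_space X d using X by (simp add: semi_computable_metric_space_def)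
  interpret Y: Metric_space Y e using Y by (simp add: semi_computable_metric_space_def)
  have \<alpha>_in: "the (\<alpha> k) \<in> X" if "k \<in> dom \<alpha>" for k
    using that X by (auto simp: semi_computable_metric_space_def ran_def)
  have \<beta>_in: "the (\<beta> l) \<in> Y" if "l \<in> dom \<beta>" for l
    using that Y by (auto simp: semi_computable_metric_space_def ran_def)
  have mem_graph: "prod_encode (t, j) \<in> coded_graph (Some \<circ> u) \<longleftrightarrow> u t = j" for t j u
    by (auto simp: coded_graph_def)
  have rpos: "(0::real) < of_rat (r t)" for t using computable_pos_rat_seq_pos[OF r(1)] by simp
  \<comment> \<open>Density yields a suitable index for each \<open>t\<close>, and choice collects
    them into a name.\<close>
  have "\<exists>u. is_name d \<alpha> r x u" if "x \<in> X" for x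
  proof -
    have "\<exists>j. j \<in> dom \<alpha> \<and> d (the (\<alpha> j)) x < of_rat (r t)" for t
      using semi_computable_metric_space_dense[OF X that rpos] by blast
    then show ?thesis unfolding is_name_def by metis
  qed
  then have name_ex: "\<exists>u. is_name d \<alpha> r x u" if "x \<in> E" for x using that assms(1) by blast

  have sound: "e (the (\<beta> l)) (f x) < of_rat (r n)"
    if x: "x \<in> E" and S: "(k, m, l, n) \<in> operator_system d e \<alpha> \<beta> r W"
      and k: "d (the (\<alpha> k)) x < of_rat (r m)" for x k m l n
  proof -
    have fx: "x \<in> X" "f x \<in> Y" using x assms(1,2) by auto
    obtain n' l0 v where *: "(prod_encode (n', l0), v) \<in> W" "functional_code v" "k \<in> dom \<alpha>"
      and near: "\<And>c. c \<in> set_decode v \<Longrightarrow>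
        dist_below d \<alpha> r (snd (prod_decode c)) k (fst (prod_decode c)) m"
      and l: "dist_below e \<beta> r l0 l n n'"
      using S mem_set_decode_less unfolding operator_system_def by blast
    obtain u0 where u0: "is_name d \<alpha> r x u0" using name_ex[OF x] by blast
    \<comment> \<open>The finite function coded by \<open>v\<close>, completed by the arbitrary name
      \<open>u0\<close> off its domain. Since \<open>v\<close> is functional, \<open>SOME\<close>
      picks the only value.\<close>
    define u where "u t = (if \<exists>j. prod_encode (t, j) \<in> set_decode v
      then SOME j. prod_encode (t, j) \<in> set_decode v else u0 t)" for t
    have u_eq: "u t = j" if "prod_encode (t, j) \<in> set_decode v" for t j
    proof -
      have "prod_encode (t, u t) \<in> set_decode v"
        unfolding u_def using that by (auto intro: someI)
      then show ?thesis using *(2) that unfolding functional_code_def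
        by (metis fst_conv prod.inject prod_encode_inverse)
    qed
    have "u t \<in> dom \<alpha> \<and> d (the (\<alpha> (u t))) x < of_rat (r t)" for t
    proof (cases "\<exists>j. prod_encode (t, j) \<in> set_decode v")
      case True
      then have "dist_below d \<alpha> r (u t) k t m" using u_eq near by force
      then have "u t \<in> dom \<alpha>" "d (the (\<alpha> (u t))) (the (\<alpha> k)) < of_rat (r t) - of_rat (r m)"
        by (auto simp: dist_below_def)
      \<comment> \<open>The distance from \<open>\<alpha> (u t)\<close> to \<open>x\<close> is below
        \<open>(r t - r m) + r m\<close>, via \<open>\<alpha> k\<close>.\<close>
      then show ?thesis
        using k X.triangle[of "the (\<alpha> (u t))" "the (\<alpha> k)" x] \<alpha>_in fx(1) *(3) by fastforce
    next
      case False
      then show ?thesis using u0 by (simp add: u_def is_name_def)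
    qed
    then have "is_name d \<alpha> r x u" by (simp add: is_name_def)
    then obtain w where w: "F (Some \<circ> u) = Some \<circ> w" "is_name e \<beta> r (f x) w" using F x by blast
    \<comment> \<open>The graph of \<open>u\<close> thus triggers the output
      \<open>(n', l0)\<close>, so the name \<open>w\<close> of \<open>f x\<close> takes the value
      \<open>l0\<close> at \<open>n'\<close>.\<close>
    have "set_decode v \<subseteq> coded_graph (Some \<circ> u)"
    proof
      fix c assume c: "c \<in> set_decode v"
      obtain t j where "c = prod_encode (t, j)" by (metis prod_decode_inverse surj_pair)
      then show "c \<in> coded_graph (Some \<circ> u)" using c u_eq mem_graph by simp
    qed
    then have "prod_encode (n', l0) \<in> coded_graph (Some \<circ> w)"
      using *(1) W[of "Some \<circ> u"] w(1) by (auto simp: enumeration_op_def)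
    then have "w n' = l0" by (simp add: mem_graph)
    then have "e (the (\<beta> l0)) (f x) < of_rat (r n')" using w(2) by (auto simp: is_name_def)
    moreover have "l0 \<in> dom \<beta>" "l \<in> dom \<beta>"
      "e (the (\<beta> l0)) (the (\<beta> l)) < of_rat (r n) - of_rat (r n')"
      using l by (auto simp: dist_below_def)
    \<comment> \<open>The distance from \<open>\<beta> l\<close> to \<open>f x\<close> is below
      \<open>(r n - r n') + r n'\<close>, via \<open>\<beta> l0\<close>.\<close>
    ultimately show ?thesis
      using Y.triangle[of "the (\<beta> l)" "the (\<beta> l0)" "f x"] \<beta>_in fx(2)
        Y.commute[of "the (\<beta> l)" "the (\<beta> l0)"] by fastforce
  qed

  have complete: "\<exists>m. \<forall>k\<in>dom \<alpha>. d (the (\<alpha> k)) x < of_rat (r m) \<longrightarrow>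
      (\<exists>l. (k, m, l, n) \<in> operator_system d e \<alpha> \<beta> r W)" if x: "x \<in> E" for x n
  proof -
    have xX: "x \<in> X" using x assms(1) by auto
    obtain u where u: "is_name d \<alpha> r x u" using name_ex[OF x] by blast
    then obtain w where w: "F (Some \<circ> u) = Some \<circ> w" "is_name e \<beta> r (f x) w" using F x by blast
    \<comment> \<open>A strictly finer precision makes \<open>r n - r n'\<close> positive, so that
      \<open>l = w n'\<close> itself passes the closeness test.\<close>
    obtain n' where n': "(of_rat (r n') :: real) < of_rat (r n)"
      using seq_accumulation_point_0_less[OF r(2) rpos] by blast
    \<comment> \<open>Finite use: the output at \<open>n'\<close> depends only on the finite part of
      the graph of \<open>u\<close> coded by \<open>v\<close>.\<close>
    have "prod_encode (n', w n') \<in> enumeration_op W (coded_graph (Some \<circ> u))"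
      using W[of "Some \<circ> u"] w(1) mem_graph by metis
    then obtain v where v: "(prod_encode (n', w n'), v) \<in> W" "set_decode v \<subseteq> coded_graph (Some \<circ> u)"
      by (auto simp: enumeration_op_def)
    have v_eq: "snd (prod_decode c) = u (fst (prod_decode c))" if "c \<in> set_decode v" for c
      using that v(2) by (auto simp: coded_graph_def)
    then have "functional_code v" unfolding functional_code_def by (metis prod.expand prod_decode_eq)
    define gap :: "nat \<Rightarrow> real" where "gap t = of_rat (r t) - d (the (\<alpha> (u t))) x" for t
    \<comment> \<open>The element 0 keeps the set nonempty, so that \<open>Min\<close> is meaningful
      when \<open>v\<close> codes the empty set.\<close>
    let ?T = "insert 0 ((fst \<circ> prod_decode) ` set_decode v)"
    have "finite ?T" by simp
    have "0 < Min (gap ` ?T)"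
      using u \<open>finite ?T\<close> by (subst Min_gr_iff) (auto simp: gap_def is_name_def)
    \<comment> \<open>One \<open>r m\<close> pays for passing from \<open>x\<close> to
      \<open>\<alpha> k\<close>, the other is the slack demanded by \<open>dist_below\<close>; hence
      half the least gap.\<close>
    then obtain m where m: "of_rat (r m) < Min (gap ` ?T) / 2"
      using seq_accumulation_point_0_less[OF r(2), of "Min (gap ` ?T) / 2"] by auto
    have gap: "2 * of_rat (r m) < gap (fst (prod_decode c))" if "c \<in> set_decode v" for c
    proof -
      have "Min (gap ` ?T) \<le> gap (fst (prod_decode c))" using that by (intro Min_le) auto
      then show ?thesis using m by linarith
    qed
    have "(k, m, w n', n) \<in> operator_system d e \<alpha> \<beta> r W"
      if k: "k \<in> dom \<alpha>" "d (the (\<alpha> k)) x < of_rat (r m)" for k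
    proof -
      have "dist_below d \<alpha> r (snd (prod_decode c)) k (fst (prod_decode c)) m"
        if c: "c \<in> set_decode v" for c
      proof -
        let ?t = "fst (prod_decode c)"
        have "u ?t \<in> dom \<alpha>" using u by (simp add: is_name_def)
        moreover from this have "d (the (\<alpha> (u ?t))) (the (\<alpha> k)) \<le> d (the (\<alpha> (u ?t))) x + d (the (\<alpha> k)) x"
          using X.triangle[of "the (\<alpha> (u ?t))" x "the (\<alpha> k)"] X.commute[of x] \<alpha>_in xX k(1) by metis
        ultimately show ?thesis
          using gap[OF c] k unfolding v_eq[OF c] dist_below_def gap_def by simp
      qed
      \<comment> \<open>The distance from \<open>\<beta> (w n')\<close> to itself is 0, below the
        positive \<open>r n - r n'\<close>.\<close>
      moreover have "dist_below e \<beta> r (w n') (w n') n n'"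
        using w(2) n' \<beta>_in[of "w n'"] by (simp add: dist_below_def is_name_def)
      ultimately show ?thesis
        using k(1) v(1) \<open>functional_code v\<close> unfolding operator_system_def by blast
    qed
    then show ?thesis by blast
  qed

  have "operator_system d e \<alpha> \<beta> r W \<subseteq> dom \<alpha> \<times> UNIV \<times> dom \<beta> \<times> UNIV"
    unfolding operator_system_def dist_below_def by blast
  then show ?thesis unfolding approximation_system_def using sound complete by blast
qed

theorem theorem3p26:
  fixes X :: "'a set" and d :: "'a \<Rightarrow> 'a \<Rightarrow> real"
    and Y :: "'b set" and e :: "'b \<Rightarrow> 'b \<Rightarrow> real"
    and E :: "'a set" and f :: "'a \<Rightarrow> 'b"
    and \<alpha> :: "nat \<rightharpoonup> 'a" and \<beta> :: "nat \<rightharpoonup> 'b"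
    and r :: "nat \<Rightarrow> rat"
  assumes "E \<subseteq> X" and "f \<in> E \<rightarrow> Y"
    and "computable_pos_rat_seq r"
    and "seq_accumulation_point r 0"
    and "semi_computable_metric_space X d \<alpha>"
    and "semi_computable_metric_space Y e \<beta>"
    and "name_computable d e \<alpha> \<beta> r E f"
  shows "\<exists>S. approximation_system d e \<alpha> \<beta> r E f S \<and> saturated \<alpha> \<beta> S \<and> rec_enumerable4 S"
proof -
  obtain F W where F: "\<And>x u. x \<in> E \<Longrightarrow> is_name d \<alpha> r x u \<Longrightarrow>
      \<exists>v. F (Some \<circ> u) = Some \<circ> v \<and> is_name e \<beta> r (f x) v"
    and W: "rec_enumerable2 W" "\<And>\<phi>. coded_graph (F \<phi>) = enumeration_op W (coded_graph \<phi>)"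
    using assms(7) unfolding name_computable_def recursive_operator_def by metis
  show ?thesis
    using approximation_system_operator_system[OF assms(1-6) W(2) F] saturated_operator_system
      rec_enumerable4_operator_system[OF assms(5,6,3) W(1)] by blast
qed

end
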